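(* Let $\mathcal{I}$ be a nonempty collection of subsets of $\{1,\ldots,n\}$ with $\emptyset\notin\mathcal{I}$, let $\hat c\in\mathbb{R}^n$ with $\hat c\ge 0$, let $d\in\mathbb{R}^n$ with $d>0$ (componentwise), and let $\Gamma\ge 1$ be an integer. Let $\mathcal{Z}$, $\mathcal{Z}_\eta$ and $\mathbb{H}$ be as defined in the context. Then $$\min_{I\in\mathcal{I}}\max_{z\in\mathcal{Z}_\eta}\sum_{j\in I}(\hat c_j+d_jz_j)<\min_{I\in\mathcal{I}}\max_{z\in\mathcal{Z}}\sum_{j\in I}(\hat c_j+d_jz_j)\qquad\forall\,\eta\in\mathbb{H}$$ if there exists an optimal solution $I^{\mathrm{RO}}$ of the robust optimization problem $\min_{I\in\mathcal{I}}\max_{z\in\mathcal{Z}}\sum_{j\in I}(\hat c_j+d_jz_j)$ that satisfies either of the following two conditions: (a) $|I^{\mathrm{RO}}|\ge\Gamma$ and there exists an optimal solution $I^*$ of the non-robust problem $\min_{I\in\mathcal{I}}\sum_{j\in I}\hat c_j$ that satisfies $I^{\mathrm{RO}}\cap I^*=\emptyset$. (b) The problem $\max_{z\in\mathcal{Z}}\sum_{j\in I^{\mathrm{RO}}}(\hat c_j+d_jz_j)$ has a unique optimal solution $\tilde z$, and there is an optimal solution $I^*$ of the non-robust problem $\min_{I\in\mathcal{I}}\sum_{j\in I}\hat c_j$ that satisfies $\mathrm{supp}(\tilde z)\cap I^*=\emptyset$.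
   Context: Definitions: the budget uncertainty set is $\mathcal{Z}:=\{z\in[0,1]^n:\sum_{j=1}^nz_j\le\Gamma\}$. For $\eta\in\mathbb{R}$ the reduced uncertainty set is $\mathcal{Z}_\eta:=\{z\in\mathcal{Z}:\min_{I\in\mathcal{I}}\sum_{j\in I}(\hat c_j+d_jz_j)\ge\eta\}$. The half-open interval $$\mathbb{H}:=\Big(\min_{I\in\mathcal{I}}\sum_{j\in I}\hat c_j,\ \max_{z\in\mathcal{Z}}\min_{I\in\mathcal{I}}\sum_{j\in I}(\hat c_j+d_jz_j)\Big].$$ For $z\in\mathcal{Z}$, $\mathrm{supp}(z):=\{j:z_j>0\}$. *)

theory Defs
  imports "HOL-Analysis.Analysis"
begin

text \<open>
  The index set {1,...,n} is an arbitrary finite type 'n, so vectors of length n have type real ^ 'n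
  and feasible solutions have type 'n set.  A collection of feasible solutions is automatically
  finite, hence its minima are written with Min.  Maxima over the (infinite) uncertainty sets are
  written as suprema; the lemmas below show that they are attained.
\<close>

definition cost :: "real ^ 'n \<Rightarrow> real ^ 'n \<Rightarrow> 'n set \<Rightarrow> real ^ 'n \<Rightarrow> real" where
  "cost c d I z = (\<Sum>j\<in>I. c $ j + d $ j * z $ j)"

definition nominal_cost :: "real ^ 'n \<Rightarrow> 'n set \<Rightarrow> real" where
  "nominal_cost c I = (\<Sum>j\<in>I. c $ j)"

definition worst_case :: "real ^ 'n \<Rightarrow> real ^ 'n \<Rightarrow> (real ^ 'n) set \<Rightarrow> 'n set \<Rightarrow> real" where
  "worst_case c d U I = (SUP z\<in>U. cost c d I z)"

definition budget_set :: "nat \<Rightarrow> (real ^ 'n) set" where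
  "budget_set \<Gamma> = {z. (\<forall>j. 0 \<le> z $ j \<and> z $ j \<le> 1) \<and> (\<Sum>j\<in>UNIV. z $ j) \<le> real \<Gamma>}"

definition reduced_set ::
    "'n set set \<Rightarrow> real ^ 'n \<Rightarrow> real ^ 'n \<Rightarrow> nat \<Rightarrow> real \<Rightarrow> (real ^ 'n) set" where
  "reduced_set \<I> c d \<Gamma> \<eta> = {z \<in> budget_set \<Gamma>. (MIN I\<in>\<I>. cost c d I z) \<ge> \<eta>}"

definition eta_interval :: "'n set set \<Rightarrow> real ^ 'n \<Rightarrow> real ^ 'n \<Rightarrow> nat \<Rightarrow> real set" where
  "eta_interval \<I> c d \<Gamma> =
     {(MIN I\<in>\<I>. nominal_cost c I) <.. (SUP z\<in>budget_set \<Gamma>. MIN I\<in>\<I>. cost c d I z)}"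

definition supp :: "real ^ 'n \<Rightarrow> 'n set" where
  "supp z = {j. z $ j > 0}"

lemma continuous_on_cost: "continuous_on S (cost c d I)"
  unfolding cost_def by (intro continuous_intros)

lemma continuous_on_Min_cost:
  assumes "\<I> \<noteq> {}"
  shows "continuous_on S (\<lambda>z. MIN I\<in>\<I>. cost c d I z)"
proof -
  have "finite \<I>" by simp
  then show ?thesis using assms
  proof (induction \<I> rule: finite_ne_induct)
    case (singleton I)
    then show ?case by (simp add: continuous_on_cost)
  next
    case (insert I F)
    then show ?case by (simp add: continuous_on_min continuous_on_cost)
  qed
qed

lemma zero_in_budget_set: "0 \<in> budget_set \<Gamma>"
  by (simp add: budget_set_def)

lemma compact_budget_set: "compact (budget_set \<Gamma> :: (real ^ 'n) set)"
proof -
  have eq: "budget_set \<Gamma> = cbox 0 (\<chi> j. 1) \<inter> {z :: real ^ 'n. (\<Sum>j\<in>UNIV. z $ j) \<le> real \<Gamma>}"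
    by (auto simp: budget_set_def mem_box_cart)
  have "closed {z :: real ^ 'n. (\<Sum>j\<in>UNIV. z $ j) \<le> real \<Gamma>}"
    by (intro closed_Collect_le continuous_intros)
  then show ?thesis
    unfolding eq by (intro compact_Int_closed compact_cbox)
qed

lemma compact_reduced_set:
  assumes "\<I> \<noteq> {}"
  shows "compact (reduced_set \<I> c d \<Gamma> \<eta>)"
proof -
  have eq: "reduced_set \<I> c d \<Gamma> \<eta> = budget_set \<Gamma> \<inter> {z. \<eta> \<le> (MIN I\<in>\<I>. cost c d I z)}"
    by (auto simp: reduced_set_def)
  have "closed {z. \<eta> \<le> (MIN I\<in>\<I>. cost c d I z)}"
    by (intro closed_Collect_le continuous_on_const continuous_on_Min_cost assms)
  then show ?thesis
    unfolding eq by (intro compact_Int_closed compact_budget_set)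
qed

lemma SUP_attained:
  fixes f :: "'a::topological_space \<Rightarrow> real"
  assumes "compact S" "S \<noteq> {}" "continuous_on S f"
  shows "\<exists>z\<in>S. (SUP x\<in>S. f x) = f z \<and> (\<forall>x\<in>S. f x \<le> f z)"
proof -
  obtain z where z: "z \<in> S" "\<forall>x\<in>S. f x \<le> f z"
    using continuous_attains_sup[OF assms] by blast
  then have "(SUP x\<in>S. f x) = f z"
    by (intro cSup_eq_maximum) auto
  with z show ?thesis by blast
qed

lemma worst_case_attained:
  assumes "compact U" "U \<noteq> {}"
  shows "\<exists>z\<in>U. worst_case c d U I = cost c d I z \<and> (\<forall>x\<in>U. cost c d I x \<le> cost c d I z)"
  unfolding worst_case_def by (intro SUP_attained assms continuous_on_cost)

lemma eta_interval_upper_attained: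
  assumes "\<I> \<noteq> {}"
  shows "\<exists>z\<in>budget_set \<Gamma>.
    (SUP x\<in>budget_set \<Gamma>. MIN I\<in>\<I>. cost c d I x) = (MIN I\<in>\<I>. cost c d I z)
    \<and> (\<forall>x\<in>budget_set \<Gamma>. (MIN I\<in>\<I>. cost c d I x) \<le> (MIN I\<in>\<I>. cost c d I z))"
  using zero_in_budget_set
  by (intro SUP_attained compact_budget_set continuous_on_Min_cost assms) auto

lemma reduced_set_nonempty:
  assumes "\<I> \<noteq> {}" "\<eta> \<in> eta_interval \<I> c d \<Gamma>"
  shows "reduced_set \<I> c d \<Gamma> \<eta> \<noteq> {}"
  using eta_interval_upper_attained[OF assms(1), of \<Gamma> c d] assms(2)
  by (fastforce simp: eta_interval_def reduced_set_def)

end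

theory Submission
  imports Defs
begin

text \<open>
  Every maximiser over the full budget set of the cost of a robust solution vanishes on some nominal
  optimum: under (b) by assumption, under (a) because otherwise budget could be moved from the nominal
  optimum to an unsaturated index of the robust solution.  At such a scenario the nominal optimum costs
  only the nominal minimum, which is less than \<open>\<eta>\<close>, so the reduced set contains no maximiser, and the
  worst case of the robust solution strictly decreases.
\<close>

text \<open>Of the two coordinates that change, only \<open>j\<close> lies in \<open>I\<close>, so
  the loss at \<open>k\<close> does not enter the cost.\<close>

lemma cost_axis_shift:
  fixes I :: "'n::finite set"
  assumes "j \<in> I" "k \<notin> I"
  shows "cost c d I (z + axis j e - axis k e) = cost c d I z + d $ j * e"
proof -
  have "cost c d I (z + axis j e - axis k e)
      = (\<Sum>i\<in>I. c $ i + d $ i * z $ i + (if i = j then d $ j * e else 0))"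
    unfolding cost_def using assms by (intro sum.cong) (auto simp: axis_def algebra_simps)
  also have "\<dots> = cost c d I z + d $ j * e"
    using assms(1) by (simp add: sum.distrib cost_def)
  finally show ?thesis .
qed

lemma sum_axis: "(\<Sum>i\<in>UNIV. axis j e $ i) = (e :: real)"
  by (simp add: axis_def)

text \<open>The shift keeps the total, and the two upper bounds on \<open>e\<close> are the room
  left at \<open>j\<close> and the supply at \<open>k\<close>.\<close>

lemma axis_shift_in_budget_set:
  fixes z :: "real ^ 'n::finite"
  assumes z: "z \<in> budget_set \<Gamma>" and "j \<noteq> k" "0 \<le> e" "e \<le> 1 - z $ j" "e \<le> z $ k"
  shows "z + axis j e - axis k e \<in> budget_set \<Gamma>"
proof -
  have box: "0 \<le> z $ i \<and> z $ i \<le> 1" for i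
    using z by (simp add: budget_set_def)
  have "0 \<le> (z + axis j e - axis k e) $ i \<and> (z + axis j e - axis k e) $ i \<le> 1" for i
    using assms(2-5) box[of i] by (auto simp: axis_def)
  moreover have "(\<Sum>i\<in>UNIV. (z + axis j e - axis k e) $ i) \<le> real \<Gamma>"
    using z by (simp add: sum.distrib sum_subtractf sum_axis budget_set_def)
  ultimately show ?thesis
    by (simp add: budget_set_def)
qed

text \<open>An exchange argument: budget spent on \<open>k\<close> outside \<open>I\<close> earns
  nothing, while \<open>d > 0\<close> makes it profitable at any index of \<open>I\<close> that
  still has room.\<close>

lemma cost_maximiser_zero_outside:
  fixes I :: "'n::finite set"
  assumes d: "\<forall>j. d $ j > 0" and card: "card I \<ge> \<Gamma>"
    and max: "is_arg_max (cost c d I) (\<lambda>z. z \<in> budget_set \<Gamma>) z" and k: "k \<notin> I"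
  shows "z $ k = 0"
proof (rule ccontr)
  assume "z $ k \<noteq> 0"
  have z: "z \<in> budget_set \<Gamma>"
    using max by (simp add: is_arg_max_def)
  then have nonneg: "0 \<le> z $ i" for i
    by (simp add: budget_set_def)
  then have pos: "0 < z $ k"
    using \<open>z $ k \<noteq> 0\<close> by (simp add: less_le)
  \<comment> \<open>Were all of \<open>I\<close> saturated, \<open>I\<close> alone would use
    \<open>card I \<ge> \<Gamma>\<close>, and the positive \<open>z $ k\<close> would exceed the
    budget.\<close>
  obtain j where j: "j \<in> I" "z $ j < 1"
  proof (rule ccontr)
    assume "\<not> thesis"
    then have "\<forall>i\<in>I. 1 \<le> z $ i"
      using that by force
    then have "real (card I) \<le> (\<Sum>i\<in>I. z $ i)"
      using sum_mono[of I "\<lambda>_. 1" "\<lambda>i. z $ i"] by simp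
    moreover have "(\<Sum>i\<in>insert k I. z $ i) \<le> (\<Sum>i\<in>UNIV. z $ i)"
      using nonneg by (intro sum_mono2) auto
    moreover have "(\<Sum>i\<in>UNIV. z $ i) \<le> real \<Gamma>"
      using z by (simp add: budget_set_def)
    ultimately show False
      using k pos card by simp
  qed
  \<comment> \<open>The largest amount that can move from \<open>k\<close> to \<open>j\<close>
    without leaving the unit box.\<close>
  define e where "e = min (z $ k) (1 - z $ j)"
  have "0 < e"
    using pos j by (simp add: e_def)
  have "z + axis j e - axis k e \<in> budget_set \<Gamma>"
    using j(1) k \<open>0 < e\<close> by (intro axis_shift_in_budget_set z) (auto simp: e_def)
  moreover have "cost c d I z < cost c d I (z + axis j e - axis k e)"
    using d \<open>0 < e\<close> by (simp add: cost_axis_shift[OF j(1) k])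
  ultimately show False
    using max by (auto simp: is_arg_max_def)
qed

lemma MIN_eq_is_arg_min:
  fixes f :: "'a \<Rightarrow> 'b::linorder"
  assumes "finite A" "is_arg_min f (\<lambda>x. x \<in> A) a"
  shows "(MIN x\<in>A. f x) = f a"
  using assms by (intro Min_eqI) (auto simp: is_arg_min_linorder)

text \<open>Strictness comes from the open left end of \<open>eta_interval\<close>, which is the
  nominal minimum.\<close>

lemma notin_reduced_set_if_vanishes_on_nominal_optimum:
  fixes \<I> :: "'n::finite set set"
  assumes \<eta>: "\<eta> \<in> eta_interval \<I> c d \<Gamma>"
    and star: "is_arg_min (nominal_cost c) (\<lambda>I. I \<in> \<I>) I"
    and zero: "\<forall>k\<in>I. z $ k = 0"
  shows "z \<notin> reduced_set \<I> c d \<Gamma> \<eta>"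
proof -
  have "(MIN J\<in>\<I>. cost c d J z) \<le> cost c d I z"
    using star by (simp add: is_arg_min_def)
  also have "\<dots> = nominal_cost c I"
    using zero by (simp add: cost_def nominal_cost_def)
  also have "\<dots> < \<eta>"
    using \<eta> MIN_eq_is_arg_min[OF _ star] by (simp add: eta_interval_def)
  finally show ?thesis
    by (simp add: reduced_set_def)
qed

text \<open>Excluding all maximisers lowers a supremum strictly only if the smaller supremum is
  attained; compactness ensures this, and \<open>\<eta>\<close> not exceeding the upper end of the
  interval makes the reduced set nonempty.\<close>

lemma worst_case_reduced_set_less:
  fixes \<I> :: "'n::finite set set"
  assumes "\<I> \<noteq> {}" and \<eta>: "\<eta> \<in> eta_interval \<I> c d \<Gamma>"
    and notin: "\<And>z. is_arg_max (cost c d I) (\<lambda>z. z \<in> budget_set \<Gamma>) z \<Longrightarrow>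
      z \<notin> reduced_set \<I> c d \<Gamma> \<eta>"
  shows "worst_case c d (reduced_set \<I> c d \<Gamma> \<eta>) I < worst_case c d (budget_set \<Gamma>) I"
proof -
  obtain z where z: "z \<in> reduced_set \<I> c d \<Gamma> \<eta>"
      "worst_case c d (reduced_set \<I> c d \<Gamma> \<eta>) I = cost c d I z"
    using worst_case_attained[OF compact_reduced_set reduced_set_nonempty] assms(1) \<eta> by metis
  obtain y where y: "y \<in> budget_set \<Gamma>" "worst_case c d (budget_set \<Gamma>) I = cost c d I y"
      "\<forall>x\<in>budget_set \<Gamma>. cost c d I x \<le> cost c d I y"
    using worst_case_attained[OF compact_budget_set] zero_in_budget_set by (metis empty_iff)
  have "z \<in> budget_set \<Gamma>"
    using z(1) by (simp add: reduced_set_def)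
  moreover have "\<not> is_arg_max (cost c d I) (\<lambda>z. z \<in> budget_set \<Gamma>) z"
    using notin z(1) by blast
  ultimately have "\<exists>x\<in>budget_set \<Gamma>. cost c d I z < cost c d I x"
    by (auto simp: is_arg_max_def)
  then show ?thesis
    using y z(2) by fastforce
qed

theorem corollary3:
  fixes \<I> :: "'n::finite set set" and c d :: "real ^ 'n" and \<Gamma> :: nat
  assumes "\<I> \<noteq> {}" and "{} \<notin> \<I>"
    and "\<forall>j. c $ j \<ge> 0" and "\<forall>j. d $ j > 0"
    and "\<Gamma> \<ge> 1"
    and "\<exists>I_RO. is_arg_min (worst_case c d (budget_set \<Gamma>)) (\<lambda>I. I \<in> \<I>) I_RO \<and>
      ((card I_RO \<ge> \<Gamma> \<and>
        (\<exists>I_star. is_arg_min (nominal_cost c) (\<lambda>I. I \<in> \<I>) I_star \<and> I_RO \<inter> I_star = {}))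
      \<or>
       (\<exists>z_opt. is_arg_max (cost c d I_RO) (\<lambda>z. z \<in> budget_set \<Gamma>) z_opt \<and>
        (\<forall>z. is_arg_max (cost c d I_RO) (\<lambda>z. z \<in> budget_set \<Gamma>) z \<longrightarrow> z = z_opt) \<and>
        (\<exists>I_star. is_arg_min (nominal_cost c) (\<lambda>I. I \<in> \<I>) I_star \<and> supp z_opt \<inter> I_star = {})))"
  shows "\<forall>\<eta> \<in> eta_interval \<I> c d \<Gamma>.
    (MIN I\<in>\<I>. worst_case c d (reduced_set \<I> c d \<Gamma> \<eta>) I)
      < (MIN I\<in>\<I>. worst_case c d (budget_set \<Gamma>) I)"
proof
  fix \<eta> assume \<eta>: "\<eta> \<in> eta_interval \<I> c d \<Gamma>"
  obtain I where I: "is_arg_min (worst_case c d (budget_set \<Gamma>)) (\<lambda>I. I \<in> \<I>) I"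
    and "(card I \<ge> \<Gamma> \<and>
        (\<exists>I_star. is_arg_min (nominal_cost c) (\<lambda>I. I \<in> \<I>) I_star \<and> I \<inter> I_star = {}))
      \<or>
       (\<exists>z_opt. is_arg_max (cost c d I) (\<lambda>z. z \<in> budget_set \<Gamma>) z_opt \<and>
        (\<forall>z. is_arg_max (cost c d I) (\<lambda>z. z \<in> budget_set \<Gamma>) z \<longrightarrow> z = z_opt) \<and>
        (\<exists>I_star. is_arg_min (nominal_cost c) (\<lambda>I. I \<in> \<I>) I_star \<and> supp z_opt \<inter> I_star = {}))"
    using assms(6) by blast
  \<comment> \<open>From here on both conditions are used only through this common
    consequence.\<close>
  then obtain I_star where star: "is_arg_min (nominal_cost c) (\<lambda>I. I \<in> \<I>) I_star"
    and zero: "\<And>z k. is_arg_max (cost c d I) (\<lambda>z. z \<in> budget_set \<Gamma>) z \<Longrightarrow> k \<in> I_star \<Longrightarrow> z $ k = 0"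
  proof (elim disjE conjE exE)
    fix J
    assume "card I \<ge> \<Gamma>" and J: "is_arg_min (nominal_cost c) (\<lambda>I. I \<in> \<I>) J" "I \<inter> J = {}"
    then show ?thesis
      using that[OF J(1)] cost_maximiser_zero_outside[OF assms(4)] by (metis disjoint_iff)
  next
    fix z_opt J
    assume uniq: "\<forall>z. is_arg_max (cost c d I) (\<lambda>z. z \<in> budget_set \<Gamma>) z \<longrightarrow> z = z_opt"
      and J: "is_arg_min (nominal_cost c) (\<lambda>I. I \<in> \<I>) J" "supp z_opt \<inter> J = {}"
    \<comment> \<open>Uniqueness identifies \<open>z\<close> with \<open>z_opt\<close>; lying
      outside the support only rules out a positive entry, and the box constraint rules out a
      negative one.\<close>
    have "z $ k = 0" if "is_arg_max (cost c d I) (\<lambda>z. z \<in> budget_set \<Gamma>) z" "k \<in> J" for z k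
    proof -
      have "\<not> z $ k > 0"
        using that uniq J(2) by (auto simp: supp_def)
      moreover have "z $ k \<ge> 0"
        using that(1) by (simp add: is_arg_max_def budget_set_def)
      ultimately show ?thesis by simp
    qed
    then show ?thesis
      using that J(1) by blast
  qed
  \<comment> \<open>\<open>I\<close> may fail to be optimal over the reduced set, but its value
    there still bounds that minimum from above.\<close>
  have "(MIN I\<in>\<I>. worst_case c d (reduced_set \<I> c d \<Gamma> \<eta>) I)
      \<le> worst_case c d (reduced_set \<I> c d \<Gamma> \<eta>) I"
    using I by (simp add: is_arg_min_def)
  also have "\<dots> < worst_case c d (budget_set \<Gamma>) I"
    using zero notin_reduced_set_if_vanishes_on_nominal_optimum[OF \<eta> star]
    by (intro worst_case_reduced_set_less assms(1) \<eta>) blast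
  also have "\<dots> = (MIN I\<in>\<I>. worst_case c d (budget_set \<Gamma>) I)"
    using MIN_eq_is_arg_min[OF _ I] by simp
  finally show "(MIN I\<in>\<I>. worst_case c d (reduced_set \<I> c d \<Gamma> \<eta>) I)
      < (MIN I\<in>\<I>. worst_case c d (budget_set \<Gamma>) I)" .
qed

end
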